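(* Consider a massive piston of mass $M=\varepsilon^{-2}$ in a container with one light particle of mass $1$ on each side, the piston being at rest at the initial moment (see context). Then the values of the action variables $I_l$ and $I_r$ are preserved with accuracy $O(\varepsilon)$ on a time interval of length $\varepsilon^{-1}$.
   Context: A container $[0,L]$ (the thickness of the piston being subtracted) contains a piston of mass $M$ at position $X\in(0,L)$ with momentum $P$, a left particle of mass $1$ at $x_l\in[0,X]$ with momentum $p_l$, and a right particle of mass $1$ at $x_r\in[X,L]$ with momentum $p_r$. The motion is one-dimensional, free between collisions, and all collisions (particle with container wall, particle with piston) are elastic: in a collision of a particle of velocity $v$ with the piston of velocity $V$, $V'=V+\frac{2}{M+1}(v-V)$, $v'=2V-v+\frac{2}{M+1}(v-V)$; at the container walls $v'=-v$. The actions are $I_l=|p_l|X/\pi$ and $I_r=|p_r|(L-X)/\pi$. The small parameter is $\varepsilon=1/\sqrt M$. The length $L$ is of order $1$; at the initial moment the piston is at rest, and the initial energy of the system (hence the initial data $X(0)\in(0,L)$, $I_l(0)>0$, $I_r(0)>0$) does not depend on $M$. Initial conditions leading to simultaneous collisions of both particles with the piston (a set of measure zero) are excluded. $O(\cdot)$ is as $\varepsilon\to0$ with constants independent of $\varepsilon$ and $t$. *)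

theory Defs
  imports Complex_Main
begin

text \<open>The light particles have unit mass, so their momenta are also their velocities; the
  velocity of the piston is its momentum divided by \<open>M\<close>.\<close>

record piston_state =
  piston_pos :: real
  piston_mom :: real
  left_pos :: real
  left_mom :: real
  right_pos :: real
  right_mom :: real

definition piston_vel :: "real \<Rightarrow> piston_state \<Rightarrow> real" where
  "piston_vel M s = piston_mom s / M"

definition admissible :: "real \<Rightarrow> piston_state \<Rightarrow> bool" where
  "admissible L s \<longleftrightarrow>
     0 < piston_pos s \<and> piston_pos s < L \<and>
     0 \<le> left_pos s \<and> left_pos s \<le> piston_pos s \<and>
     piston_pos s \<le> right_pos s \<and> right_pos s \<le> L"

definition left_action :: "piston_state \<Rightarrow> real" where
  "left_action s = \<bar>left_mom s\<bar> * piston_pos s / pi"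

definition right_action :: "real \<Rightarrow> piston_state \<Rightarrow> real" where
  "right_action L s = \<bar>right_mom s\<bar> * (L - piston_pos s) / pi"

text \<open>A hit is a contact with the two bodies approaching each other; a contact with the bodies
  separating is the situation just after a collision.\<close>

definition left_wall_hit :: "piston_state \<Rightarrow> bool" where
  "left_wall_hit s \<longleftrightarrow> left_pos s = 0 \<and> left_mom s < 0"

definition right_wall_hit :: "real \<Rightarrow> piston_state \<Rightarrow> bool" where
  "right_wall_hit L s \<longleftrightarrow> right_pos s = L \<and> 0 < right_mom s"

definition left_piston_hit :: "real \<Rightarrow> piston_state \<Rightarrow> bool" where
  "left_piston_hit M s \<longleftrightarrow> left_pos s = piston_pos s \<and> piston_vel M s < left_mom s"

definition right_piston_hit :: "real \<Rightarrow> piston_state \<Rightarrow> bool" where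
  "right_piston_hit M s \<longleftrightarrow> right_pos s = piston_pos s \<and> right_mom s < piston_vel M s"

definition piston_vel_after :: "real \<Rightarrow> real \<Rightarrow> real \<Rightarrow> real" where
  "piston_vel_after M V v = V + 2 / (M + 1) * (v - V)"

definition particle_vel_after :: "real \<Rightarrow> real \<Rightarrow> real \<Rightarrow> real" where
  "particle_vel_after M V v = 2 * V - v + 2 / (M + 1) * (v - V)"

text \<open>The effect of all collisions taking place in a given state (the identity if there are none).
  Collisions of the left and of the right particle may coincide in time, except that both particles
  hitting the piston at once is excluded in \<open>motion\<close> below; the order of the branches in the update
  of the piston is therefore immaterial.\<close>

definition collide :: "real \<Rightarrow> real \<Rightarrow> piston_state \<Rightarrow> piston_state" where
  "collide M L s = s\<lparr>
     piston_mom :=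
       (if left_piston_hit M s then M * piston_vel_after M (piston_vel M s) (left_mom s)
        else if right_piston_hit M s then M * piston_vel_after M (piston_vel M s) (right_mom s)
        else piston_mom s),
     left_mom :=
       (if left_wall_hit s then - left_mom s
        else if left_piston_hit M s then particle_vel_after M (piston_vel M s) (left_mom s)
        else left_mom s),
     right_mom :=
       (if right_wall_hit L s then - right_mom s
        else if right_piston_hit M s then particle_vel_after M (piston_vel M s) (right_mom s)
        else right_mom s)\<rparr>"

definition free_flight :: "real \<Rightarrow> real \<Rightarrow> piston_state \<Rightarrow> piston_state" where
  "free_flight M d s = s\<lparr>
     piston_pos := piston_pos s + d * piston_vel M s,
     left_pos := left_pos s + d * left_mom s,
     right_pos := right_pos s + d * right_mom s\<rparr>"

text \<open>The state at a collision time is the one before the collision, so \<open>z\<close> is left-continuous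
  and the initial state may itself be a collision state. The times \<open>\<tau> n\<close> contain all collision
  times: a hit strictly between two of them would be followed by a violation of \<open>admissible\<close>.
  Times \<open>\<tau> n\<close> without a collision are harmless.\<close>

definition motion :: "real \<Rightarrow> real \<Rightarrow> (real \<Rightarrow> piston_state) \<Rightarrow> bool" where
  "motion M L z \<longleftrightarrow>
     (\<exists>\<tau>::nat \<Rightarrow> real. \<tau> 0 = 0 \<and> strict_mono \<tau> \<and> filterlim \<tau> at_top sequentially \<and>
        (\<forall>n. \<forall>t\<in>{\<tau> n<..\<tau> (Suc n)}.
           z t = free_flight M (t - \<tau> n) (collide M L (z (\<tau> n))))) \<and>
     (\<forall>t\<ge>0. admissible L (z t)) \<and>
     (\<forall>t\<ge>0. \<not> (left_piston_hit M (z t) \<and> right_piston_hit M (z t)))"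

end

theory Submission
  imports Defs
begin

text \<open>Write \<open>X\<close>, \<open>V\<close> for position and velocity of the piston and \<open>x\<close>, \<open>v\<close> for those of
  the left particle. The theorem rests on the moment \<open>J = v X - V x\<close>. Free flight conserves \<open>J\<close>,
  since its derivative is \<open>v V - V v\<close>. A reflection at the wall \<open>x = 0\<close> turns \<open>J\<close> into \<open>- J\<close>, and so
  does an elastic collision with the piston: there \<open>J = (v - V) X\<close>, and the relative velocity
  changes sign. Hence only collisions of the \<^emph>\<open>right\<close> particle with the piston change \<open>\<bar>J\<bar>\<close>, and they
  do so by \<open>x\<close> times the jump of \<open>V\<close>, which is \<open>O(\<epsilon>\<^sup>2)\<close>. By conservation of energy \<open>V = O(\<epsilon>)\<close>, so
  \<open>\<bar>J\<bar>\<close> is within \<open>O(\<epsilon>)\<close> of \<open>\<pi> I\<^sub>l\<close>. It remains to see that the right particle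
  hits the piston \<open>O(1/\<epsilon>)\<close> times during a time \<open>1/\<epsilon>\<close>; the right moment is
  treated in the same way by reflecting the container.

  The collisions are counted by a phase. Let \<open>D\<close> be the distance of a particle from its own wall,
  with a negative sign while the particle moves towards that wall. It grows at the rate \<open>\<bar>v\<bar>\<close>, which is
  bounded by the energy, it is continuous at reflections from the wall, and it drops by twice the
  width of the compartment when the particle hits the piston. The width is bounded below as long
  as the moment is: the moment is at most a constant times the width, up to
  \<open>O(\<epsilon>)\<close>. Such a lower bound on the moment also makes the particle faster than the piston, so that it
  does reverse its direction in the collision. Both moments therefore have to be controlled
  together; the invariant \<open>controlled\<close> does this by bounding the drift of each moment by a
  multiple of \<open>\<epsilon>\<^sup>2\<close> times what the phase of the other particle has lost relative to its maximal
  possible growth. It is propagated from one collision time to the next.\<close>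

section \<open>Moment, phase and energy\<close>

definition left_moment :: "real \<Rightarrow> piston_state \<Rightarrow> real" where
  "left_moment M s = left_mom s * piston_pos s - piston_vel M s * left_pos s"

definition left_phase :: "piston_state \<Rightarrow> real" where
  "left_phase s = sgn (left_mom s) * left_pos s"

definition twice_energy :: "real \<Rightarrow> piston_state \<Rightarrow> real" where
  "twice_energy M s = M * (piston_vel M s)\<^sup>2 + (left_mom s)\<^sup>2 + (right_mom s)\<^sup>2"

definition mirror :: "real \<Rightarrow> piston_state \<Rightarrow> piston_state" where
  "mirror L s = \<lparr>piston_pos = L - piston_pos s, piston_mom = - piston_mom s,
     left_pos = L - right_pos s, left_mom = - right_mom s,
     right_pos = L - left_pos s, right_mom = - left_mom s\<rparr>"

lemma mirror_sel [simp]: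
  "piston_pos (mirror L s) = L - piston_pos s"
  "piston_mom (mirror L s) = - piston_mom s"
  "piston_vel M (mirror L s) = - piston_vel M s"
  "left_pos (mirror L s) = L - right_pos s"
  "left_mom (mirror L s) = - right_mom s"
  "right_pos (mirror L s) = L - left_pos s"
  "right_mom (mirror L s) = - left_mom s"
  by (simp_all add: mirror_def piston_vel_def)

lemma mirror_mirror [simp]: "mirror L (mirror L s) = s"
  by (simp add: mirror_def)

lemma mirror_hits [simp]:
  "left_wall_hit (mirror L s) = right_wall_hit L s"
  "right_wall_hit L (mirror L s) = left_wall_hit s"
  "left_piston_hit M (mirror L s) = right_piston_hit M s"
  "right_piston_hit M (mirror L s) = left_piston_hit M s"
  by (auto simp: left_wall_hit_def right_wall_hit_def left_piston_hit_def right_piston_hit_def)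

lemma admissible_mirror [simp]: "admissible L (mirror L s) = admissible L s"
  by (auto simp: admissible_def)

lemma twice_energy_mirror [simp]: "twice_energy M (mirror L s) = twice_energy M s"
  by (simp add: twice_energy_def)

lemma right_action_mirror: "right_action L s = left_action (mirror L s)"
  by (simp add: right_action_def left_action_def)

lemma mirror_free_flight: "free_flight M d (mirror L s) = mirror L (free_flight M d s)"
  by (rule piston_state.equality) (simp_all add: free_flight_def)

lemma vel_after_uminus:
  "piston_vel_after M (- V) (- v) = - piston_vel_after M V v"
  "particle_vel_after M (- V) (- v) = - particle_vel_after M V v"
  by (simp_all add: piston_vel_after_def particle_vel_after_def right_diff_distrib)

text \<open>Two simultaneous hits of the piston have to be excluded because \<open>collide\<close> then lets the left
  particle act on the piston, which breaks the symmetry.\<close>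

lemma mirror_collide:
  assumes "\<not> (left_piston_hit M s \<and> right_piston_hit M s)"
  shows "collide M L (mirror L s) = mirror L (collide M L s)"
  using assms
  by (intro piston_state.equality)
     (auto simp: collide_def vel_after_uminus)

lemma elastic_relative_velocity:
  "particle_vel_after M V v - piston_vel_after M V v = V - v"
  by (simp add: particle_vel_after_def piston_vel_after_def)

lemma elastic_energy:
  assumes "0 < M"
  shows "M * (piston_vel_after M V v)\<^sup>2 + (particle_vel_after M V v)\<^sup>2 = M * V\<^sup>2 + v\<^sup>2"
proof -
  define k where "k = 2 / (M + 1)"
  have k: "k * (M + 1) = 2"
    using assms by (simp add: k_def field_simps)
  have "M * (V + k * (v - V))\<^sup>2 + (2 * V - v + k * (v - V))\<^sup>2
      = M * V\<^sup>2 + v\<^sup>2 + (v - V)\<^sup>2 * k * (k * (M + 1) - 2) + 2 * V * (v - V) * (k * (M + 1) - 2)"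
    by algebra
  then show ?thesis
    by (simp add: k piston_vel_after_def particle_vel_after_def flip: k_def)
qed

lemma piston_vel_collide:
  assumes "0 < M"
  shows "piston_vel M (collide M L s) =
    (if left_piston_hit M s then piston_vel_after M (piston_vel M s) (left_mom s)
     else if right_piston_hit M s then piston_vel_after M (piston_vel M s) (right_mom s)
     else piston_vel M s)"
  using assms by (simp add: collide_def piston_vel_def)

lemma pos_collide [simp]:
  "piston_pos (collide M L s) = piston_pos s"
  "left_pos (collide M L s) = left_pos s"
  "right_pos (collide M L s) = right_pos s"
  by (simp_all add: collide_def)

lemma admissible_collide [simp]: "admissible L (collide M L s) = admissible L s"
  by (simp add: admissible_def)

lemma left_mom_collide:
  "left_mom (collide M L s) =
    (if left_wall_hit s then - left_mom s
     else if left_piston_hit M s then particle_vel_after M (piston_vel M s) (left_mom s)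
     else left_mom s)"
  by (simp add: collide_def)

lemma right_mom_collide:
  "right_mom (collide M L s) =
    (if right_wall_hit L s then - right_mom s
     else if right_piston_hit M s then particle_vel_after M (piston_vel M s) (right_mom s)
     else right_mom s)"
  by (simp add: collide_def)

lemma wall_and_piston_hit_exclusive:
  assumes "admissible L s"
  shows "left_wall_hit s \<Longrightarrow> \<not> left_piston_hit M s"
    and "right_wall_hit L s \<Longrightarrow> \<not> right_piston_hit M s"
  using assms
  by (auto simp: admissible_def left_wall_hit_def left_piston_hit_def
      right_wall_hit_def right_piston_hit_def)

lemma twice_energy_collide:
  assumes "0 < M" "admissible L s" "\<not> (left_piston_hit M s \<and> right_piston_hit M s)"
  shows "twice_energy M (collide M L s) = twice_energy M s"
  using elastic_energy[OF assms(1), of "piston_vel M s" "left_mom s"]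
    elastic_energy[OF assms(1), of "piston_vel M s" "right_mom s"]
    wall_and_piston_hit_exclusive[OF assms(2), of M] assms(3)
  by (auto simp: twice_energy_def piston_vel_collide[OF assms(1)] left_mom_collide right_mom_collide)

lemma free_flight_sel [simp]:
  "piston_pos (free_flight M d s) = piston_pos s + d * piston_vel M s"
  "left_pos (free_flight M d s) = left_pos s + d * left_mom s"
  "right_pos (free_flight M d s) = right_pos s + d * right_mom s"
  "piston_vel M' (free_flight M d s) = piston_vel M' s"
  "left_mom (free_flight M d s) = left_mom s"
  "right_mom (free_flight M d s) = right_mom s"
  by (simp_all add: free_flight_def piston_vel_def)

lemma twice_energy_free_flight [simp]: "twice_energy M (free_flight M d s) = twice_energy M s"
  by (simp add: twice_energy_def)

lemma left_moment_free_flight [simp]: "left_moment M (free_flight M d s) = left_moment M s"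
  by (simp add: left_moment_def algebra_simps)

lemma left_phase_free_flight:
  "left_phase (free_flight M d s) = left_phase s + d * \<bar>left_mom s\<bar>"
  by (simp add: left_phase_def algebra_simps abs_sgn)

lemma abs_left_phase_le:
  assumes "admissible L s"
  shows "\<bar>left_phase s\<bar> \<le> L"
  using assms by (auto simp: left_phase_def admissible_def sgn_if)

text \<open>The left moment is affine in the velocity of the piston with coefficient \<open>- x\<close>. A hit from
  the right shifts that velocity and may coincide with a reflection of the left particle at the
  wall, where the coefficient vanishes.\<close>

lemma left_moment_collide:
  assumes "0 < M" "admissible L s" "\<not> (left_piston_hit M s \<and> right_piston_hit M s)"
  shows "\<bar>\<bar>left_moment M (collide M L s)\<bar> - \<bar>left_moment M s\<bar>\<bar>
    \<le> (if right_piston_hit M s then L * (2 / (M + 1) * \<bar>right_mom s - piston_vel M s\<bar>) else 0)"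
proof (cases "left_piston_hit M s")
  case True
  then have "left_moment M (collide M L s) = - left_moment M s"
    using wall_and_piston_hit_exclusive(1)[OF assms(2), of M]
      elastic_relative_velocity[of M "piston_vel M s" "left_mom s"]
    by (auto simp: left_moment_def piston_vel_collide[OF assms(1)] left_mom_collide
        left_piston_hit_def minus_diff_eq simp flip: left_diff_distrib mult_minus_left)
  then show ?thesis
    using True assms(3) by simp
next
  case False
  show ?thesis
  proof (cases "left_wall_hit s")
    case True
    then have "left_moment M (collide M L s) = - left_moment M s"
      using False by (auto simp: left_moment_def left_mom_collide left_wall_hit_def)
    then show ?thesis
      using assms by (auto simp: admissible_def)
  next
    case no_wall: False
    have x: "0 \<le> left_pos s" "left_pos s \<le> L"
      using assms(2) by (auto simp: admissible_def)
    define \<delta> where "\<delta> = 2 / (M + 1) * (right_mom s - piston_vel M s)"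
    have "left_moment M (collide M L s) =
        left_moment M s - (if right_piston_hit M s then left_pos s * \<delta> else 0)"
      using False no_wall
      by (simp add: left_moment_def piston_vel_collide[OF assms(1)] left_mom_collide
          piston_vel_after_def \<delta>_def algebra_simps)
    moreover have "\<bar>left_pos s * \<delta>\<bar> \<le> L * \<bar>\<delta>\<bar>"
      using x by (simp add: abs_mult mult_right_mono)
    moreover have "\<bar>\<delta>\<bar> = 2 / (M + 1) * \<bar>right_mom s - piston_vel M s\<bar>"
      using assms(1) unfolding \<delta>_def abs_mult by simp
    ultimately show ?thesis
      by (smt (verit))
  qed
qed

lemma left_phase_collide_no_hit:
  assumes "\<not> left_piston_hit M s"
  shows "left_phase (collide M L s) = left_phase s"
  using assms by (auto simp: left_phase_def left_mom_collide left_wall_hit_def)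

lemma left_phase_collide_hit:
  assumes "admissible L s" "left_piston_hit M s"
    and "0 < left_mom s" "left_mom (collide M L s) < 0"
  shows "left_phase (collide M L s) = left_phase s - 2 * piston_pos s"
  using assms by (auto simp: left_phase_def left_piston_hit_def)

section \<open>Propagation of the moment bounds\<close>

text \<open>Here \<open>\<sigma>\<^sup>2\<close> is twice the energy and \<open>2 j\<close> a lower bound for both initial moments. A hit shifts
  the velocity of the piston by at most \<open>4 \<epsilon>\<^sup>2 \<sigma>\<close>, hence the other moment by at most
  \<open>4 \<epsilon>\<^sup>2 \<sigma> L\<close>, while a moment of at least \<open>j\<close> forces a phase drop of at least \<open>j / \<sigma>\<close>; the quotient
  of the two is \<open>\<kappa> \<epsilon>\<^sup>2\<close>. The assumption \<open>small_drift\<close> keeps both moments above \<open>j\<close> up to time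
  \<open>1/\<epsilon>\<close>, and \<open>fast\<close> makes a particle with such a moment outrun the piston.\<close>

locale heavy_piston =
  fixes L M \<epsilon> \<sigma> j \<kappa> :: real
  assumes L_pos: "0 < L" and \<epsilon>_pos: "0 < \<epsilon>" and \<epsilon>_le_1: "\<epsilon> \<le> 1" and M_eq: "M = 1 / \<epsilon>\<^sup>2"
    and \<sigma>_pos: "0 < \<sigma>" and j_pos: "0 < j" and \<kappa>_eq: "\<kappa> = 4 * \<sigma>\<^sup>2 * L / j"
    and fast: "8 * \<epsilon> * \<sigma> * L \<le> j" and small_drift: "\<epsilon> * (\<kappa> * (\<sigma> + 2 * L)) \<le> j"
begin

text \<open>The phase starts at \<open>L\<close> at most and grows at most at the rate \<open>\<sigma>\<close>, so the right-hand sides vanish or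
  are positive initially, never decrease in free flight, and increase at each hit of the
  piston by \<open>\<kappa> \<epsilon>\<^sup>2\<close> times the drop of the phase. They thus count the hits without reference to
  the times at which these occur.\<close>

definition controlled :: "real \<Rightarrow> real \<Rightarrow> real \<Rightarrow> piston_state \<Rightarrow> bool" where
  "controlled jl jr t s \<longleftrightarrow> admissible L s \<and> twice_energy M s = \<sigma>\<^sup>2 \<and>
     \<bar>\<bar>left_moment M s\<bar> - jl\<bar> \<le> \<kappa> * \<epsilon>\<^sup>2 * (\<sigma> * t + L - left_phase (mirror L s)) \<and>
     \<bar>\<bar>left_moment M (mirror L s)\<bar> - jr\<bar> \<le> \<kappa> * \<epsilon>\<^sup>2 * (\<sigma> * t + L - left_phase s)"

lemma M_pos: "0 < M"
  using \<epsilon>_pos by (simp add: M_eq)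

lemma \<kappa>_pos: "0 < \<kappa>"
  using \<sigma>_pos L_pos j_pos by (simp add: \<kappa>_eq)

lemma controlled_mirror: "controlled jl jr t s \<Longrightarrow> controlled jr jl t (mirror L s)"
  by (auto simp: controlled_def)

lemma velocity_bounds:
  assumes "twice_energy M s = \<sigma>\<^sup>2"
  shows "\<bar>piston_vel M s\<bar> \<le> \<epsilon> * \<sigma>" "\<bar>left_mom s\<bar> \<le> \<sigma>" "\<bar>right_mom s\<bar> \<le> \<sigma>"
proof -
  have *: "M * (piston_vel M s)\<^sup>2 + (left_mom s)\<^sup>2 + (right_mom s)\<^sup>2 = \<sigma>\<^sup>2"
    using assms by (simp add: twice_energy_def)
  have nn: "0 \<le> M * (piston_vel M s)\<^sup>2"
    using M_pos by simp
  have "\<epsilon>\<^sup>2 * (M * (piston_vel M s)\<^sup>2) \<le> \<epsilon>\<^sup>2 * \<sigma>\<^sup>2"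
    using * by (intro mult_left_mono) (smt (verit) zero_le_power2, simp)
  then have "(piston_vel M s)\<^sup>2 \<le> (\<epsilon> * \<sigma>)\<^sup>2"
    using \<epsilon>_pos by (simp add: M_eq power_mult_distrib)
  then show "\<bar>piston_vel M s\<bar> \<le> \<epsilon> * \<sigma>"
    using \<epsilon>_pos \<sigma>_pos by (simp add: abs_le_square_iff[symmetric])
  have "(left_mom s)\<^sup>2 \<le> \<sigma>\<^sup>2" "(right_mom s)\<^sup>2 \<le> \<sigma>\<^sup>2"
    using * nn zero_le_power2[of "left_mom s"] zero_le_power2[of "right_mom s"] by linarith+
  then show "\<bar>left_mom s\<bar> \<le> \<sigma>" "\<bar>right_mom s\<bar> \<le> \<sigma>"
    using \<sigma>_pos by (simp_all add: abs_le_square_iff[symmetric])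
qed

text \<open>The two quantities differ by the term \<open>V x\<close> only.\<close>

lemma left_moment_near_action:
  assumes "admissible L s" "twice_energy M s = \<sigma>\<^sup>2"
  shows "\<bar>\<bar>left_moment M s\<bar> - \<bar>left_mom s\<bar> * piston_pos s\<bar> \<le> \<epsilon> * \<sigma> * L"
proof -
  have X: "0 < piston_pos s" and x: "0 \<le> left_pos s" "left_pos s \<le> L"
    using assms(1) by (auto simp: admissible_def)
  have "\<bar>\<bar>left_moment M s\<bar> - \<bar>left_mom s * piston_pos s\<bar>\<bar> \<le> \<bar>piston_vel M s * left_pos s\<bar>"
    unfolding left_moment_def by linarith
  also have "\<dots> \<le> \<epsilon> * \<sigma> * L"
    using velocity_bounds(1)[OF assms(2)] x \<epsilon>_pos \<sigma>_pos
    by (auto simp: abs_mult intro!: mult_mono)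
  finally show ?thesis
    using X by (simp add: abs_mult)
qed

text \<open>Up to \<open>\<epsilon> \<sigma> L\<close> the moment is the product of speed and width. One factor is small only if the
  other is large, but the speed cannot exceed \<open>\<sigma>\<close> and the width cannot exceed \<open>L\<close>.\<close>

lemma large_left_moment:
  assumes "admissible L s" "twice_energy M s = \<sigma>\<^sup>2" "j \<le> \<bar>left_moment M s\<bar>"
  shows "2 * \<epsilon> * \<sigma> < \<bar>left_mom s\<bar>" "j / (2 * \<sigma>) \<le> piston_pos s"
proof -
  have X: "0 < piston_pos s" "piston_pos s \<le> L"
    using assms(1) by (auto simp: admissible_def)
  have low: "j - \<epsilon> * \<sigma> * L \<le> \<bar>left_mom s\<bar> * piston_pos s"
    using left_moment_near_action[OF assms(1,2)] assms(3) by linarith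
  also have "\<dots> \<le> \<bar>left_mom s\<bar> * L"
    using X by (intro mult_left_mono) auto
  finally have "7 * \<epsilon> * \<sigma> * L \<le> \<bar>left_mom s\<bar> * L"
    using fast by (simp add: algebra_simps)
  then have "7 * \<epsilon> * \<sigma> \<le> \<bar>left_mom s\<bar>"
    using L_pos by simp
  moreover have "0 < \<epsilon> * \<sigma>"
    using \<epsilon>_pos \<sigma>_pos by simp
  ultimately show "2 * \<epsilon> * \<sigma> < \<bar>left_mom s\<bar>"
    by linarith
  have "\<bar>left_mom s\<bar> * piston_pos s \<le> \<sigma> * piston_pos s"
    using velocity_bounds(2)[OF assms(2)] X by (intro mult_right_mono) auto
  then have "j / 2 \<le> \<sigma> * piston_pos s"
    using low fast j_pos by linarith
  then show "j / (2 * \<sigma>) \<le> piston_pos s"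
    using \<sigma>_pos by (simp add: field_simps)
qed

text \<open>The particle hits the piston from inside its compartment and is faster than the piston, so it
  moves towards the piston; afterwards it recedes at the old relative speed, which exceeds
  the speed of the piston.\<close>

lemma left_phase_drop:
  assumes "admissible L s" "twice_energy M s = \<sigma>\<^sup>2" "j \<le> \<bar>left_moment M s\<bar>"
    and "left_piston_hit M s" "\<not> right_piston_hit M s"
  shows "j / \<sigma> \<le> left_phase s - left_phase (collide M L s)"
proof -
  let ?s = "collide M L s"
  have E: "twice_energy M ?s = \<sigma>\<^sup>2"
    using twice_energy_collide[OF M_pos assms(1)] assms(2,5) by simp
  note V = velocity_bounds(1)[OF assms(2)] velocity_bounds(1)[OF E]
  note big = large_left_moment[OF assms(1-3)]
  have hit: "piston_vel M s < left_mom s"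
    using assms(4) by (simp add: left_piston_hit_def)
  have pos: "0 < left_mom s" "\<epsilon> * \<sigma> + \<bar>piston_vel M s\<bar> < left_mom s"
    using hit big(1) V(1) by linarith+
  have "left_mom ?s - piston_vel M ?s = piston_vel M s - left_mom s"
    using assms(4) wall_and_piston_hit_exclusive(1)[OF assms(1), of M]
    by (auto simp: left_mom_collide piston_vel_collide[OF M_pos] elastic_relative_velocity)
  then have "left_mom ?s < 0"
    using pos V by linarith
  then have "left_phase ?s = left_phase s - 2 * piston_pos s"
    using left_phase_collide_hit assms(1,4) pos(1) by blast
  then show ?thesis
    using big(2) by (simp add: field_simps)
qed

lemma left_moment_drift_collide:
  assumes "admissible L s" "twice_energy M s = \<sigma>\<^sup>2" "j \<le> \<bar>left_moment M (mirror L s)\<bar>"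
    and single: "\<not> (left_piston_hit M s \<and> right_piston_hit M s)"
  shows "\<bar>\<bar>left_moment M (collide M L s)\<bar> - \<bar>left_moment M s\<bar>\<bar>
    \<le> \<kappa> * \<epsilon>\<^sup>2 * (left_phase (mirror L s) - left_phase (mirror L (collide M L s)))"
proof (cases "right_piston_hit M s")
  case False
  then have "left_phase (mirror L (collide M L s)) = left_phase (mirror L s)"
    using left_phase_collide_no_hit[of M "mirror L s" L] mirror_collide[OF single] by simp
  then show ?thesis
    using left_moment_collide[OF M_pos assms(1) single] False by simp
next
  case True
  have "\<bar>right_mom s - piston_vel M s\<bar> \<le> \<sigma> + \<epsilon> * \<sigma>"
    using velocity_bounds[OF assms(2)] by linarith
  also have "\<dots> \<le> 2 * \<sigma>"
    using \<epsilon>_le_1 \<sigma>_pos by simp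
  finally have rel: "\<bar>right_mom s - piston_vel M s\<bar> \<le> 2 * \<sigma>" .
  have "2 / (M + 1) \<le> 2 / M"
    using M_pos by (simp add: frac_le)
  also have "\<dots> = 2 * \<epsilon>\<^sup>2"
    by (simp add: M_eq)
  finally have "2 / (M + 1) * \<bar>right_mom s - piston_vel M s\<bar> \<le> (2 * \<epsilon>\<^sup>2) * (2 * \<sigma>)"
    using rel by (intro mult_mono) auto
  then have "L * (2 / (M + 1) * \<bar>right_mom s - piston_vel M s\<bar>) \<le> L * ((2 * \<epsilon>\<^sup>2) * (2 * \<sigma>))"
    using L_pos by (intro mult_left_mono) auto
  also have "\<dots> = \<kappa> * \<epsilon>\<^sup>2 * (j / \<sigma>)"
    using j_pos \<sigma>_pos by (simp add: \<kappa>_eq power2_eq_square)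
  also have "\<dots> \<le> \<kappa> * \<epsilon>\<^sup>2 * (left_phase (mirror L s) - left_phase (mirror L (collide M L s)))"
    using left_phase_drop[of "mirror L s"] assms True \<kappa>_pos
    by (intro mult_left_mono) (auto simp: mirror_collide[OF single])
  finally show ?thesis
    using left_moment_collide[OF M_pos assms(1) single] True by simp
qed

text \<open>The time bound turns the right-hand side in \<open>controlled\<close> into \<open>O(\<epsilon>)\<close>: the length \<open>1/\<epsilon>\<close> of the
  time interval cancels one of the two factors \<open>\<epsilon>\<close>.\<close>

lemma left_moment_drift:
  assumes "controlled jl jr t s" "t \<le> 1 / \<epsilon>"
  shows "\<bar>\<bar>left_moment M s\<bar> - jl\<bar> \<le> \<epsilon> * (\<kappa> * (\<sigma> + 2 * L))"
proof -
  have "\<bar>left_phase (mirror L s)\<bar> \<le> L"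
    using assms(1) by (intro abs_left_phase_le) (simp add: controlled_def)
  moreover have "\<sigma> * t \<le> \<sigma> * (1 / \<epsilon>)"
    using assms(2) \<sigma>_pos by (intro mult_left_mono) auto
  ultimately have "\<sigma> * t + L - left_phase (mirror L s) \<le> \<sigma> / \<epsilon> + 2 * L"
    by (simp add: abs_if split: if_splits)
  also have "\<dots> \<le> (\<sigma> + 2 * L) / \<epsilon>"
  proof -
    have "2 * L \<le> 2 * L / \<epsilon>"
      using \<epsilon>_pos \<epsilon>_le_1 L_pos by (simp add: le_divide_eq mult_left_le)
    then show ?thesis
      by (simp add: add_divide_distrib)
  qed
  finally have "\<kappa> * \<epsilon>\<^sup>2 * (\<sigma> * t + L - left_phase (mirror L s)) \<le> \<kappa> * \<epsilon>\<^sup>2 * ((\<sigma> + 2 * L) / \<epsilon>)"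
    using \<kappa>_pos by (intro mult_left_mono) auto
  also have "\<dots> = \<epsilon> * (\<kappa> * (\<sigma> + 2 * L))"
    using \<epsilon>_pos by (simp add: power2_eq_square)
  finally show ?thesis
    using assms(1) unfolding controlled_def by linarith
qed

lemma controlled_collide:
  assumes c: "controlled jl jr t s" and "t \<le> 1 / \<epsilon>" "2 * j \<le> jl" "2 * j \<le> jr"
    and single: "\<not> (left_piston_hit M s \<and> right_piston_hit M s)"
  shows "controlled jl jr t (collide M L s)"
proof -
  have s: "admissible L s" "twice_energy M s = \<sigma>\<^sup>2"
    using c by (auto simp: controlled_def)
  have large: "j \<le> \<bar>left_moment M s\<bar>" "j \<le> \<bar>left_moment M (mirror L s)\<bar>"
    using left_moment_drift[OF c assms(2)]
      left_moment_drift[OF controlled_mirror[OF c] assms(2)] small_drift assms(3,4)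
    by linarith+
  have "\<bar>\<bar>left_moment M (collide M L s)\<bar> - \<bar>left_moment M s\<bar>\<bar>
    \<le> \<kappa> * \<epsilon>\<^sup>2 * (left_phase (mirror L s) - left_phase (mirror L (collide M L s)))"
    using left_moment_drift_collide s large(2) single by blast
  moreover have "\<bar>\<bar>left_moment M (mirror L (collide M L s))\<bar> - \<bar>left_moment M (mirror L s)\<bar>\<bar>
    \<le> \<kappa> * \<epsilon>\<^sup>2 * (left_phase s - left_phase (collide M L s))"
    using left_moment_drift_collide[of "mirror L s"] s large(1) single
    by (simp add: mirror_collide[OF single] conj_commute)
  moreover have "b + \<kappa> * \<epsilon>\<^sup>2 * (a - a') \<le> \<kappa> * \<epsilon>\<^sup>2 * (\<sigma> * t + L - a')"
    if "b \<le> \<kappa> * \<epsilon>\<^sup>2 * (\<sigma> * t + L - a)" for a a' b :: real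
    using that by (simp add: algebra_simps)
  ultimately have
    "\<bar>\<bar>left_moment M (collide M L s)\<bar> - jl\<bar>
      \<le> \<kappa> * \<epsilon>\<^sup>2 * (\<sigma> * t + L - left_phase (mirror L (collide M L s)))"
    "\<bar>\<bar>left_moment M (mirror L (collide M L s))\<bar> - jr\<bar>
      \<le> \<kappa> * \<epsilon>\<^sup>2 * (\<sigma> * t + L - left_phase (collide M L s))"
    using c unfolding controlled_def by (smt (verit, best))+
  then show ?thesis
    using s twice_energy_collide[OF M_pos s(1) single] by (simp add: controlled_def)
qed

lemma controlled_free_flight:
  assumes c: "controlled jl jr t s" and "0 \<le> d" "admissible L (free_flight M d s)"
  shows "controlled jl jr (t + d) (free_flight M d s)"
proof -
  have E: "twice_energy M s = \<sigma>\<^sup>2"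
    using c by (auto simp: controlled_def)
  have "d * \<bar>left_mom s\<bar> \<le> d * \<sigma>" "d * \<bar>right_mom s\<bar> \<le> d * \<sigma>"
    using velocity_bounds[OF E] assms(2) by (auto intro: mult_left_mono)
  then have
    "\<sigma> * t + L - left_phase s \<le> \<sigma> * (t + d) + L - left_phase (free_flight M d s)"
    "\<sigma> * t + L - left_phase (mirror L s)
      \<le> \<sigma> * (t + d) + L - left_phase (mirror L (free_flight M d s))"
    by (simp_all add: left_phase_free_flight distrib_left mult.commute[of d] flip: mirror_free_flight)
  then have mono: "\<kappa> * \<epsilon>\<^sup>2 * (\<sigma> * t + L - left_phase s)
        \<le> \<kappa> * \<epsilon>\<^sup>2 * (\<sigma> * (t + d) + L - left_phase (free_flight M d s))"
      "\<kappa> * \<epsilon>\<^sup>2 * (\<sigma> * t + L - left_phase (mirror L s))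
        \<le> \<kappa> * \<epsilon>\<^sup>2 * (\<sigma> * (t + d) + L - left_phase (mirror L (free_flight M d s)))"
    using \<kappa>_pos by (simp_all only: mult_left_mono less_imp_le mult_nonneg_nonneg zero_le_power2)
  have "left_moment M (mirror L (free_flight M d s)) = left_moment M (mirror L s)"
    by (simp flip: mirror_free_flight)
  then show ?thesis
    using c assms(3) order_trans[OF _ mono(1)] order_trans[OF _ mono(2)]
    unfolding controlled_def left_moment_free_flight twice_energy_free_flight by simp
qed

lemma controlled_motion:
  assumes m: "motion M L z" and c0: "controlled jl jr 0 (z 0)"
    and j: "2 * j \<le> jl" "2 * j \<le> jr" and t: "0 \<le> t" "t \<le> 1 / \<epsilon>"
  shows "controlled jl jr t (z t)"
proof -
  obtain \<tau> :: "nat \<Rightarrow> real" where \<tau>: "\<tau> 0 = 0" "strict_mono \<tau>" "filterlim \<tau> at_top sequentially"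
    and flight: "\<And>n t. t \<in> {\<tau> n<..\<tau> (Suc n)} \<Longrightarrow>
        z t = free_flight M (t - \<tau> n) (collide M L (z (\<tau> n)))"
    using m unfolding motion_def by blast
  have adm: "admissible L (z t)"
    and single: "\<not> (left_piston_hit M (z t) \<and> right_piston_hit M (z t))" if "0 \<le> t" for t
    using m that unfolding motion_def by blast+
  have \<tau>_nonneg: "0 \<le> \<tau> n" for n
    using strict_mono_less_eq[OF \<tau>(2), of 0 n] \<tau>(1) by simp
  have step: "controlled jl jr t (z t)"
    if "controlled jl jr (\<tau> n) (z (\<tau> n))" "t \<in> {\<tau> n<..\<tau> (Suc n)}" "t \<le> 1 / \<epsilon>" for n t
  proof -
    have "controlled jl jr (\<tau> n) (collide M L (z (\<tau> n)))"
      using that j single[OF \<tau>_nonneg] by (intro controlled_collide) auto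
    moreover have "admissible L (free_flight M (t - \<tau> n) (collide M L (z (\<tau> n))))"
      using flight[OF that(2)] adm[of t] that(2) \<tau>_nonneg[of n] by simp
    ultimately have "controlled jl jr (\<tau> n + (t - \<tau> n))
        (free_flight M (t - \<tau> n) (collide M L (z (\<tau> n))))"
      using that(2) by (intro controlled_free_flight) auto
    then show ?thesis
      using flight[OF that(2)] by simp
  qed
  have grid: "\<tau> n \<le> 1 / \<epsilon> \<Longrightarrow> controlled jl jr (\<tau> n) (z (\<tau> n))" for n
  proof (induction n)
    case 0
    then show ?case using c0 \<tau>(1) by simp
  next
    case (Suc n)
    have "\<tau> n < \<tau> (Suc n)"
      using \<tau>(2) by (simp add: strict_mono_def)
    then show ?case
      using Suc by (auto intro!: step[of n "\<tau> (Suc n)"])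
  qed
  show ?thesis
  proof (cases "t = 0")
    case True
    then show ?thesis using c0 by simp
  next
    case False
    \<comment> \<open>The first grid point not before \<open>t\<close> ends the flight that contains \<open>t\<close>.\<close>
    have "\<exists>n. t \<le> \<tau> n"
      using \<tau>(3) unfolding filterlim_at_top eventually_sequentially by blast
    then obtain k where k: "t \<le> \<tau> k" "\<And>i. i < k \<Longrightarrow> \<not> t \<le> \<tau> i"
      using exists_least_iff[of "\<lambda>n. t \<le> \<tau> n"] by blast
    then obtain n where n: "k = Suc n"
      using False t(1) \<tau>(1) by (cases k) auto
    have "\<tau> n < t"
      using k(2)[of n] n by simp
    then show ?thesis
      using k(1) n t(2) by (intro step[OF grid, of n]) auto
  qed
qed

lemma left_action_drift:
  assumes "controlled (pi * I) jr t s" "t \<le> 1 / \<epsilon>"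
  shows "\<bar>left_action s - I\<bar> \<le> (\<sigma> * L + \<kappa> * (\<sigma> + 2 * L)) / pi * \<epsilon>"
proof -
  have "admissible L s" "twice_energy M s = \<sigma>\<^sup>2"
    using assms(1) by (auto simp: controlled_def)
  then have "\<bar>\<bar>left_mom s\<bar> * piston_pos s - pi * I\<bar> \<le> \<epsilon> * \<sigma> * L + \<epsilon> * (\<kappa> * (\<sigma> + 2 * L))"
    using left_moment_near_action left_moment_drift[OF assms] by fastforce
  also have "\<dots> = (\<sigma> * L + \<kappa> * (\<sigma> + 2 * L)) * \<epsilon>"
    by (simp add: algebra_simps)
  finally have "\<bar>\<bar>left_mom s\<bar> * piston_pos s - pi * I\<bar> / pi
      \<le> (\<sigma> * L + \<kappa> * (\<sigma> + 2 * L)) * \<epsilon> / pi"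
    by (simp add: divide_right_mono)
  moreover have "left_action s - I = (\<bar>left_mom s\<bar> * piston_pos s - pi * I) / pi"
    by (simp add: left_action_def diff_divide_distrib)
  ultimately show ?thesis
    by simp
qed

end

section \<open>Conservation of the actions\<close>

theorem theorem3:
  fixes L X0 Il0 Ir0 :: real
  assumes "0 < X0" and "X0 < L" and "0 < Il0" and "0 < Ir0"
  shows "\<exists>C \<epsilon>0. 0 < \<epsilon>0 \<and>
    (\<forall>\<epsilon> M z. 0 < \<epsilon> \<longrightarrow> \<epsilon> < \<epsilon>0 \<longrightarrow> 0 < M \<longrightarrow> \<epsilon> = 1 / sqrt M \<longrightarrow> motion M L z \<longrightarrow>
       piston_mom (z 0) = 0 \<longrightarrow> piston_pos (z 0) = X0 \<longrightarrow>
       left_action (z 0) = Il0 \<longrightarrow> right_action L (z 0) = Ir0 \<longrightarrow>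
       (\<forall>t. 0 \<le> t \<and> t \<le> 1 / \<epsilon> \<longrightarrow>
          \<bar>left_action (z t) - left_action (z 0)\<bar> \<le> C * \<epsilon> \<and>
          \<bar>right_action L (z t) - right_action L (z 0)\<bar> \<le> C * \<epsilon>))"
proof -
  \<comment> \<open>The piston is initially at rest, so the actions determine the speeds and thereby the energy,
    independently of the mass.\<close>
  define \<sigma> where "\<sigma> = sqrt ((pi * Il0 / X0)\<^sup>2 + (pi * Ir0 / (L - X0))\<^sup>2)"
  define j where "j = pi * min Il0 Ir0 / 2"
  define \<kappa> where "\<kappa> = 4 * \<sigma>\<^sup>2 * L / j"
  define C where "C = (\<sigma> * L + \<kappa> * (\<sigma> + 2 * L)) / pi"
  \<comment> \<open>For \<open>\<epsilon> N \<le> j\<close> both smallness assumptions of \<open>heavy_piston\<close> hold.\<close>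
  define N where "N = 8 * \<sigma> * L + \<kappa> * (\<sigma> + 2 * L)"
  have L: "0 < L"
    using assms by simp
  have \<sigma>_sq: "\<sigma>\<^sup>2 = (pi * Il0 / X0)\<^sup>2 + (pi * Ir0 / (L - X0))\<^sup>2"
    by (simp add: \<sigma>_def)
  have \<sigma>: "0 < \<sigma>"
    using assms by (auto simp: \<sigma>_def intro!: add_pos_nonneg)
  have j: "0 < j" "2 * j \<le> pi * Il0" "2 * j \<le> pi * Ir0"
    using assms by (auto simp: j_def)
  have \<kappa>: "0 < \<kappa>"
    using \<sigma> L j by (simp add: \<kappa>_def)
  have N: "0 < 8 * \<sigma> * L" "0 < \<kappa> * (\<sigma> + 2 * L)"
    using \<sigma> L \<kappa> by auto
  then have N_pos: "0 < N"
    unfolding N_def by (rule add_pos_pos)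
  have main: "\<bar>left_action (z t) - left_action (z 0)\<bar> \<le> C * \<epsilon> \<and>
          \<bar>right_action L (z t) - right_action L (z 0)\<bar> \<le> C * \<epsilon>"
    if \<epsilon>: "0 < \<epsilon>" "\<epsilon> < min 1 (j / N)" and M: "0 < M" "\<epsilon> = 1 / sqrt M" and m: "motion M L z"
      and init: "piston_mom (z 0) = 0" "piston_pos (z 0) = X0"
        "left_action (z 0) = Il0" "right_action L (z 0) = Ir0"
      and t: "0 \<le> t" "t \<le> 1 / \<epsilon>" for \<epsilon> M z t
  proof -
    have M_eq: "M = 1 / \<epsilon>\<^sup>2"
      using M by (simp add: power_divide)
    have "\<epsilon> * N \<le> j"
      using \<epsilon>(2) N_pos by (simp add: field_simps)
    then have small: "\<epsilon> * (8 * \<sigma> * L) + \<epsilon> * (\<kappa> * (\<sigma> + 2 * L)) \<le> j"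
      by (simp add: N_def distrib_left)
    moreover have "0 < \<epsilon> * (8 * \<sigma> * L)" "0 < \<epsilon> * (\<kappa> * (\<sigma> + 2 * L))"
      using \<epsilon>(1) N by (auto intro!: mult_pos_pos)
    ultimately have "\<epsilon> * (8 * \<sigma> * L) \<le> j" "\<epsilon> * (\<kappa> * (\<sigma> + 2 * L)) \<le> j"
      by linarith+
    then interpret heavy_piston L M \<epsilon> \<sigma> j \<kappa>
      using L \<epsilon> M_eq \<sigma> j(1) by unfold_locales (auto simp: \<kappa>_def algebra_simps)
    have adm: "admissible L (z 0)"
      using m by (auto simp: motion_def)
    have V: "piston_vel M (z 0) = 0"
      using init(1) by (simp add: piston_vel_def)
    have mom: "\<bar>left_mom (z 0)\<bar> * X0 = pi * Il0" "\<bar>right_mom (z 0)\<bar> * (L - X0) = pi * Ir0"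
      using init by (auto simp: left_action_def right_action_def field_simps)
    then have "\<bar>left_mom (z 0)\<bar> = pi * Il0 / X0" "\<bar>right_mom (z 0)\<bar> = pi * Ir0 / (L - X0)"
      using assms by (simp_all add: field_simps)
    then have "twice_energy M (z 0) = \<sigma>\<^sup>2"
      by (metis V \<sigma>_sq add_0 mult_zero_right power2_abs power_zero_numeral twice_energy_def)
    \<comment> \<open>Since the piston is at rest at time \<open>0\<close>, moments and actions agree exactly up to sign and
      the factor \<open>\<pi>\<close>.\<close>
    moreover have "\<bar>left_moment M (z 0)\<bar> = pi * Il0"
        "\<bar>left_moment M (mirror L (z 0))\<bar> = pi * Ir0"
      using mom V init(2) assms by (auto simp: left_moment_def abs_mult)
    moreover have "left_phase (z 0) \<le> L" "left_phase (mirror L (z 0)) \<le> L"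
      using abs_left_phase_le[of L "z 0"] abs_left_phase_le[of L "mirror L (z 0)"] adm by auto
    ultimately have "controlled (pi * Il0) (pi * Ir0) 0 (z 0)"
      using adm \<kappa> by (simp add: controlled_def)
    then have c: "controlled (pi * Il0) (pi * Ir0) t (z t)"
      using controlled_motion m j t by blast
    show ?thesis
      using left_action_drift[OF c t(2)] left_action_drift[OF controlled_mirror[OF c] t(2)]
      by (simp add: C_def right_action_mirror init(3) init(4)[unfolded right_action_mirror])
  qed
  have "0 < min 1 (j / N)"
    using j(1) N_pos by simp
  then show ?thesis
    using main by blast
qed

end
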